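(* For every complex number $a$ with $3a+\tfrac12\notin\{0,-1,-2,\dots\}$, $$F_1\left(\tfrac12;\,2a,\,3a-\tfrac12;\,3a+\tfrac12;\,\tfrac15,-\tfrac45\right)=\sqrt{\frac35}\;\frac{\Gamma(a+1/6)\,\Gamma(a+5/6)}{\Gamma(a+1/3)\,\Gamma(a+2/3)}.$$
   Context: Appell's hypergeometric series is $F_1(\alpha;\beta_1,\beta_2;\gamma;x,y)=\sum_{m,n\ge0}\frac{(\alpha,m+n)(\beta_1,m)(\beta_2,n)}{(\gamma,m+n)(1,m)(1,n)}x^my^n$ for $\gamma\notin\{0,-1,-2,\dots\}$, absolutely convergent for $|x|<1$, $|y|<1$, where $(\alpha,n)=\alpha(\alpha+1)\cdots(\alpha+n-1)$, $(\alpha,0)=1$. $1/\Gamma$ is the entire function (zero at the poles of $\Gamma$). *)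

theory Defs
  imports "HOL-Analysis.Analysis"
begin

text \<open>
  Appell's series. The sum is the unordered sum over all pairs, which for complex
  terms exists exactly when the double series converges absolutely; this is the case for
  \<open>norm x < 1\<close>, \<open>norm y < 1\<close> and \<open>\<gamma> \<notin> \<int>\<^sub>\<le>\<^sub>0\<close>. Outside the region of absolute convergence the
  value is the default of \<open>infsum\<close> and carries no meaning.
\<close>

definition appell_F1 ::
  "complex \<Rightarrow> complex \<Rightarrow> complex \<Rightarrow> complex \<Rightarrow> complex \<Rightarrow> complex \<Rightarrow> complex" where
  "appell_F1 \<alpha> \<beta>1 \<beta>2 \<gamma> x y =
     (\<Sum>\<^sub>\<infinity>(m, n)\<in>(UNIV :: (nat \<times> nat) set).
        pochhammer \<alpha> (m + n) * pochhammer \<beta>1 m * pochhammer \<beta>2 n /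
        (pochhammer \<gamma> (m + n) * pochhammer 1 m * pochhammer 1 n) * x ^ m * y ^ n)"

end

theory Submission imports Defs begin

text \<open>
  Euler's integral for the series is, up to a Beta factor,
  \<open>\<integral>\<^sub>0\<^sup>1 t\<^bsup>-1/2\<^esup> (1 - t)\<^sup>-\<^sup>1 (1 + 4 t / 5)\<^bsup>1/2\<^esup> v\<^sup>a dt\<close> with
  \<open>v = 5\<^sup>5 (1 - t)\<^sup>3 / ((5 - t)\<^sup>2 (5 + 4 t)\<^sup>3)\<close>, and in the variable \<open>v\<close> it becomes a constant multiple of
  \<open>\<integral>\<^sub>0\<^sup>1 v\<^bsup>a-1\<^esup> (1 - v)\<^bsup>-1/2\<^esup> dv\<close>. Integrating the derivative of \<open>v\<^sup>a (1 - v)\<^bsup>1/2\<^esup>\<close> gives a recurrence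
  relating \<open>a\<close> and \<open>a + 1\<close>. This step is algebraic, so it can be carried out for the coefficient
  functional \<open>t\<^sup>k \<mapsto> (1/2, k) / (\<gamma>, k)\<close> in place of the integral, for all admissible \<open>a \<noteq> 0\<close>
  (at \<open>a = 0\<close> the series is an explicit binomial series). The
  Gamma quotient satisfies the same recurrence, and along \<open>a + n\<close> both sides tend to \<open>sqrt (3/5)\<close>: the
  terms of the series are dominated, and their limits form the binomial series of
  \<open>(1 + 2/3)\<^bsup>-1/2\<^esup>\<close>.
\<close>

section \<open>Power series with radius of convergence greater than 1\<close>

text \<open>Radius greater than 1 is the condition under which a series can be summed against the
  weights \<open>euler_weight\<close> below, which grow more slowly than every \<open>r^k\<close>
  with \<open>r > 1\<close>.\<close>

lemma conv_radius_gt_1_arith: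
  fixes f g :: "complex fps"
  assumes "fps_conv_radius f > 1" "fps_conv_radius g > 1"
  shows "fps_conv_radius (f + g) > 1" "fps_conv_radius (f - g) > 1" "fps_conv_radius (f * g) > 1"
  using assms fps_conv_radius_add[of f g] fps_conv_radius_diff[of f g] fps_conv_radius_mult[of f g]
  by (meson less_le_trans min_less_iff_conj)+

lemma conv_radius_gt_1_const:
  "fps_conv_radius (fps_const (c :: complex)) > 1" "fps_conv_radius (fps_X :: complex fps) > 1"
  "fps_conv_radius (1 :: complex fps) > 1"
  by simp_all

lemmas conv_radius_gt_1_intros = conv_radius_gt_1_arith conv_radius_gt_1_const

section \<open>Normalised Beta moments and the functional they define\<close>

definition euler_weight :: "complex \<Rightarrow> complex \<Rightarrow> nat \<Rightarrow> complex" where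
  "euler_weight \<alpha> \<gamma> k = pochhammer \<alpha> k / pochhammer \<gamma> k"

text \<open>
  Up to the factor \<open>\<Gamma>(\<gamma>) / (\<Gamma>(\<alpha>) \<Gamma>(\<gamma> - \<alpha>))\<close> this is the functional
  \<open>f \<mapsto> \<integral>\<^sub>0\<^sup>1 t\<^bsup>\<alpha>-1\<^esup> (1 - t)\<^bsup>\<gamma>-\<alpha>-1\<^esup> f(t) dt\<close>, expressed by its values on the monomials so
  that it makes sense without any condition on the real parts.
\<close>
definition euler_functional :: "complex \<Rightarrow> complex \<Rightarrow> complex fps \<Rightarrow> complex" where
  "euler_functional \<alpha> \<gamma> f = (\<Sum>k. euler_weight \<alpha> \<gamma> k * fps_nth f k)"

lemma euler_weight_rec:
  assumes "\<gamma> \<notin> \<int>\<^sub>\<le>\<^sub>0"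
  shows "euler_weight \<alpha> \<gamma> (Suc k) * (\<gamma> + of_nat k) = euler_weight \<alpha> \<gamma> k * (\<alpha> + of_nat k)"
proof -
  have "pochhammer \<gamma> (Suc k) \<noteq> 0" "pochhammer \<gamma> k \<noteq> 0"
    using assms by (auto simp: pochhammer_eq_0_iff simp del: pochhammer_Suc)
  then show ?thesis
    by (auto simp: euler_weight_def pochhammer_Suc field_simps)
qed

text \<open>The quotient of consecutive weights tends to 1; the condition on \<alpha> keeps all
  weights nonzero, so the ratio test applies.\<close>

lemma conv_radius_euler_weight:
  assumes "\<alpha> \<notin> \<int>\<^sub>\<le>\<^sub>0" "\<gamma> \<notin> \<int>\<^sub>\<le>\<^sub>0"
  shows "conv_radius (euler_weight \<alpha> \<gamma>) = 1"
proof (rule conv_radius_ratio_limit_nonzero[of _ 1])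
  have nz: "\<alpha> + of_nat k \<noteq> 0" "euler_weight \<alpha> \<gamma> k \<noteq> 0" for k
    using assms by (auto simp: euler_weight_def pochhammer_eq_0_iff add_eq_0_iff2)
  have "(\<lambda>k. norm ((\<gamma> + of_nat k) / (\<alpha> + of_nat k))) \<longlonglongrightarrow> norm (1 :: complex)"
  proof (rule tendsto_norm)
    have "(\<lambda>k. 1 + (\<gamma> - \<alpha>) * inverse (\<alpha> + of_nat k)) \<longlonglongrightarrow> 1 + (\<gamma> - \<alpha>) * 0"
      by (intro tendsto_intros tendsto_inverse_0[THEN filterlim_compose]
            tendsto_add_filterlim_at_infinity[OF tendsto_const] tendsto_of_nat)
    also have "(\<lambda>k. 1 + (\<gamma> - \<alpha>) * inverse (\<alpha> + of_nat k)) = (\<lambda>k. (\<gamma> + of_nat k) / (\<alpha> + of_nat k))"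
      using nz by (auto simp: field_simps)
    finally show "(\<lambda>k. (\<gamma> + of_nat k) / (\<alpha> + of_nat k)) \<longlonglongrightarrow> 1" by simp
  qed
  moreover have "(\<gamma> + of_nat k) / (\<alpha> + of_nat k) = euler_weight \<alpha> \<gamma> k / euler_weight \<alpha> \<gamma> (Suc k)" for k
    using euler_weight_rec[OF assms(2), of \<alpha> k] nz[of k] nz[of "Suc k"] by (simp add: field_simps)
  ultimately show "(\<lambda>k. norm (euler_weight \<alpha> \<gamma> k) / norm (euler_weight \<alpha> \<gamma> (Suc k))) \<longlonglongrightarrow> 1"
    by (simp add: norm_divide)
qed (simp_all add: one_ereal_def)

text \<open>The point \<open>1/r\<close> lies inside the disc of convergence, and the terms of a
  convergent series are bounded.\<close>

lemma euler_weight_bound: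
  assumes "\<alpha> \<notin> \<int>\<^sub>\<le>\<^sub>0" "\<gamma> \<notin> \<int>\<^sub>\<le>\<^sub>0" "r > 1"
  obtains B where "B > 0" "\<And>k. norm (euler_weight \<alpha> \<gamma> k) \<le> B * r ^ k"
proof -
  have "summable (\<lambda>k. euler_weight \<alpha> \<gamma> k * of_real (1/r) ^ k)"
    using assms by (intro summable_in_conv_radius)
      (simp add: conv_radius_euler_weight one_ereal_def norm_divide)
  then have "Bseq (\<lambda>k. euler_weight \<alpha> \<gamma> k * of_real (1/r) ^ k)"
    by (intro convergent_imp_Bseq summable_imp_convergent)
  then obtain B where B: "B > 0" "\<And>k. norm (euler_weight \<alpha> \<gamma> k * of_real (1/r) ^ k) \<le> B"
    by (auto elim: BseqE)
  have "norm (euler_weight \<alpha> \<gamma> k) \<le> B * r ^ k" for k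
    using B(2)[of k] assms(3) by (simp add: norm_mult norm_power norm_divide power_divide field_simps)
  with B(1) that show thesis by blast
qed

text \<open>Any \<open>r\<close> strictly between 1 and the radius of convergence works. Summability
  is recorded for all \<open>s\<close> up to \<open>r\<close> so that two series can later share a
  common radius.\<close>

lemma conv_radius_gt_1_obtain:
  fixes f :: "complex fps"
  assumes "fps_conv_radius f > 1"
  obtains r where "r > 1" "\<And>s. 0 \<le> s \<Longrightarrow> s \<le> r \<Longrightarrow> summable (\<lambda>k. norm (fps_nth f k) * s ^ k)"
proof -
  obtain r where r: "1 < ereal r" "ereal r < fps_conv_radius f"
    using ereal_dense2[OF assms] by auto
  have "summable (\<lambda>k. norm (fps_nth f k) * s ^ k)" if s: "0 \<le> s" "s \<le> r" for s
  proof -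
    have "ereal (norm (complex_of_real s)) < conv_radius (fps_nth f)"
      using s r by (auto simp: fps_conv_radius_def intro: le_less_trans[of _ "ereal r"])
    from abs_summable_in_conv_radius[OF this] s show ?thesis
      by (simp add: norm_mult norm_power)
  qed
  with r(1) that show thesis by auto
qed

lemma summable_euler_functional:
  assumes "\<alpha> \<notin> \<int>\<^sub>\<le>\<^sub>0" "\<gamma> \<notin> \<int>\<^sub>\<le>\<^sub>0" "fps_conv_radius f > 1"
  shows "summable (\<lambda>k. euler_weight \<alpha> \<gamma> k * fps_nth f k)"
proof -
  obtain r where r: "r > 1" "\<And>s. 0 \<le> s \<Longrightarrow> s \<le> r \<Longrightarrow> summable (\<lambda>k. norm (fps_nth f k) * s ^ k)"
    using conv_radius_gt_1_obtain[OF assms(3)] by blast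
  obtain B where B: "B > 0" "\<And>k. norm (euler_weight \<alpha> \<gamma> k) \<le> B * r ^ k"
    using euler_weight_bound[OF assms(1,2) r(1)] by blast
  show ?thesis
  proof (rule summable_comparison_test'[where N = 0])
    show "summable (\<lambda>k. B * (norm (fps_nth f k) * r ^ k))"
      using r by (intro summable_mult r(2)) auto
    show "norm (euler_weight \<alpha> \<gamma> k * fps_nth f k) \<le> B * (norm (fps_nth f k) * r ^ k)" for k
      using mult_right_mono[OF B(2)[of k], of "norm (fps_nth f k)"] by (simp add: norm_mult mult_ac)
  qed
qed

lemma euler_functional_cmult:
  assumes "\<alpha> \<notin> \<int>\<^sub>\<le>\<^sub>0" "\<gamma> \<notin> \<int>\<^sub>\<le>\<^sub>0" "fps_conv_radius f > 1"
  shows "euler_functional \<alpha> \<gamma> (fps_const c * f) = c * euler_functional \<alpha> \<gamma> f"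
  using suminf_mult[OF summable_euler_functional[OF assms], of c]
  by (simp add: euler_functional_def mult_ac)

lemma euler_functional_diff:
  assumes "\<alpha> \<notin> \<int>\<^sub>\<le>\<^sub>0" "\<gamma> \<notin> \<int>\<^sub>\<le>\<^sub>0" "fps_conv_radius f > 1" "fps_conv_radius g > 1"
  shows "euler_functional \<alpha> \<gamma> (f - g) = euler_functional \<alpha> \<gamma> f - euler_functional \<alpha> \<gamma> g"
  using suminf_diff[OF summable_euler_functional[OF assms(1,2,3)] summable_euler_functional[OF assms(1,2,4)]]
  by (simp add: euler_functional_def algebra_simps)

text \<open>
  The vanishing of the integral of the derivative of \<open>t\<^bsup>\<alpha>\<^esup> (1 - t)\<^bsup>\<gamma>-\<alpha>\<^esup> p(t)\<close>; on the level of
  coefficients the sum telescopes.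
\<close>
lemma euler_functional_total_derivative:
  assumes "\<alpha> \<notin> \<int>\<^sub>\<le>\<^sub>0" "\<gamma> \<notin> \<int>\<^sub>\<le>\<^sub>0" "fps_conv_radius p > 1"
  shows "euler_functional \<alpha> \<gamma>
           (fps_of_poly [:\<alpha>, -\<gamma>:] * p + fps_of_poly [:0, 1, -1:] * fps_deriv p) = 0"
proof -
  let ?w = "euler_weight \<alpha> \<gamma>"
  \<comment> \<open>The boundary term of the telescoping sum. Since \<open>k - 1\<close> truncates
    at 0, the value at 0 is set separately. By \<open>euler_weight_rec\<close>,
    \<open>D (Suc k)\<close> is \<open>?w k\<close> times
    \<open>(\<alpha> + of_nat k) * fps_nth p k\<close>.\<close>
  define D where "D k = (if k = 0 then 0 else ?w k * ((\<gamma> + of_nat (k - 1)) * fps_nth p (k - 1)))" for k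
  let ?f = "fps_of_poly [:\<alpha>, -\<gamma>:] * p + fps_of_poly [:0, 1, -1:] * fps_deriv p"
  have "?w k * fps_nth ?f k = D (Suc k) - D k" for k
  proof -
    have "?f = (fps_const \<alpha> * p + fps_X * fps_deriv p) - fps_X * (fps_const \<gamma> * p + fps_X * fps_deriv p)"
      by (simp add: fps_of_poly_pCons algebra_simps del: fps_const_neg flip: fps_const_neg)
    also have "fps_nth \<dots> k = (\<alpha> + of_nat k) * fps_nth p k -
            (if k = 0 then 0 else (\<gamma> + of_nat (k - 1)) * fps_nth p (k - 1))"
      by (cases k; cases "k - 1") (auto simp: algebra_simps)
    finally have *: "fps_nth ?f k = \<dots>" .
    have "D (Suc k) = ?w k * ((\<alpha> + of_nat k) * fps_nth p k)"
      using euler_weight_rec[OF assms(2), of \<alpha> k] by (simp add: D_def mult.assoc[symmetric])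
    moreover have "D k = ?w k * (if k = 0 then 0 else (\<gamma> + of_nat (k - 1)) * fps_nth p (k - 1))"
      by (simp add: D_def)
    ultimately show ?thesis unfolding * by (simp only: right_diff_distrib)
  qed
  moreover have "(\<lambda>k. D (Suc k) - D k) sums (0 - D 0)"
  proof (rule telescope_sums)
    \<comment> \<open>The terms \<open>D (Suc k)\<close> are the summands of the functional at
      \<open>\<alpha> p + t p'\<close>; that series converges, so they tend to 0.\<close>
    have conv: "fps_conv_radius (fps_const \<alpha> * p + fps_X * fps_deriv p) > 1"
      using less_le_trans[OF assms(3) fps_conv_radius_deriv] assms(3)
      by (intro conv_radius_gt_1_intros)
    have "fps_nth (fps_const \<alpha> * p + fps_X * fps_deriv p) k = (\<alpha> + of_nat k) * fps_nth p k" for k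
      by (cases k) (auto simp: algebra_simps)
    then have "?w k * fps_nth (fps_const \<alpha> * p + fps_X * fps_deriv p) k = D (Suc k)" for k
      using euler_weight_rec[OF assms(2), of \<alpha> k] by (simp add: D_def mult.assoc[symmetric])
    then have "(\<lambda>k. D (Suc k)) \<longlonglongrightarrow> 0"
      using summable_LIMSEQ_zero[OF summable_euler_functional[OF assms(1,2) conv]] by simp
    then show "D \<longlonglongrightarrow> 0" by (simp only: filterlim_sequentially_Suc)
  qed
  ultimately show ?thesis
    by (simp add: euler_functional_def D_def sums_iff)
qed

text \<open>A factor \<open>1 - t\<close> raises the exponent of \<open>1 - t\<close> in the Beta
  weight, hence \<gamma>, by one; the constant is the quotient of the two Beta
  normalisations.\<close>

lemma euler_functional_one_minus_X:
  assumes "\<alpha> \<notin> \<int>\<^sub>\<le>\<^sub>0" "\<gamma> \<notin> \<int>\<^sub>\<le>\<^sub>0" "fps_conv_radius f > 1"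
  shows "euler_functional \<alpha> \<gamma> (fps_of_poly [:1, -1:] * f) = (\<gamma> - \<alpha>) / \<gamma> * euler_functional \<alpha> (\<gamma> + 1) f"
proof -
  let ?w = "euler_weight \<alpha> \<gamma>"
  have \<gamma>: "\<gamma> \<noteq> 0" "\<gamma> + 1 \<notin> \<int>\<^sub>\<le>\<^sub>0"
    using assms(2) by (auto simp: plus_one_in_nonpos_Ints_imp)
  have X: "fps_conv_radius (fps_X * f) > 1"
    using assms(3) by (intro conv_radius_gt_1_intros)
  have "(\<lambda>k. ?w (Suc k) * fps_nth f k) sums (euler_functional \<alpha> \<gamma> (fps_X * f))"
    using summable_sums[OF summable_euler_functional[OF assms(1,2) X]]
      sums_Suc_iff[of "\<lambda>k. ?w k * fps_nth (fps_X * f) k"]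
    by (simp add: euler_functional_def)
  moreover have "(\<lambda>k. ?w k * fps_nth f k) sums (euler_functional \<alpha> \<gamma> f)"
    using summable_sums[OF summable_euler_functional[OF assms]] by (simp add: euler_functional_def)
  ultimately have "(\<lambda>k. ?w k * fps_nth f k - ?w (Suc k) * fps_nth f k) sums
      (euler_functional \<alpha> \<gamma> f - euler_functional \<alpha> \<gamma> (fps_X * f))"
    by (intro sums_diff)
  moreover have "?w k * fps_nth f k - ?w (Suc k) * fps_nth f k =
      (\<gamma> - \<alpha>) / \<gamma> * (euler_weight \<alpha> (\<gamma> + 1) k * fps_nth f k)" for k
  proof -
    have 1: "\<gamma> + of_nat k \<noteq> 0" "pochhammer \<gamma> k \<noteq> 0"
      using assms(2) by (auto simp: pochhammer_eq_0_iff add_eq_0_iff2)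
    have "\<gamma> * pochhammer (\<gamma> + 1) k = pochhammer \<gamma> k * (\<gamma> + of_nat k)"
      using pochhammer_rec[of \<gamma> k] by (simp add: pochhammer_Suc)
    then have "pochhammer (\<gamma> + 1) k = pochhammer \<gamma> k * (\<gamma> + of_nat k) / \<gamma>"
      using \<gamma> by (simp add: field_simps)
    then have "euler_weight \<alpha> (\<gamma> + 1) k = \<gamma> * (?w k / (\<gamma> + of_nat k))"
      by (simp add: euler_weight_def)
    moreover have "?w k - ?w (Suc k) = (\<gamma> - \<alpha>) * (?w k / (\<gamma> + of_nat k))"
      using euler_weight_rec[OF assms(2), of \<alpha> k] 1 by (simp add: field_simps)
    ultimately have "?w k - ?w (Suc k) = (\<gamma> - \<alpha>) / \<gamma> * euler_weight \<alpha> (\<gamma> + 1) k"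
      using \<gamma> by simp
    then show ?thesis by (metis left_diff_distrib mult.assoc)
  qed
  ultimately have "(\<lambda>k. (\<gamma> - \<alpha>) / \<gamma> * (euler_weight \<alpha> (\<gamma> + 1) k * fps_nth f k)) sums
      (euler_functional \<alpha> \<gamma> f - euler_functional \<alpha> \<gamma> (fps_X * f))"
    by simp
  moreover have "(\<lambda>k. (\<gamma> - \<alpha>) / \<gamma> * (euler_weight \<alpha> (\<gamma> + 1) k * fps_nth f k)) sums
      ((\<gamma> - \<alpha>) / \<gamma> * euler_functional \<alpha> (\<gamma> + 1) f)"
    unfolding euler_functional_def
    by (intro sums_mult summable_sums summable_euler_functional assms \<gamma>)
  ultimately have "(\<gamma> - \<alpha>) / \<gamma> * euler_functional \<alpha> (\<gamma> + 1) f =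
      euler_functional \<alpha> \<gamma> f - euler_functional \<alpha> \<gamma> (fps_X * f)"
    by (rule sums_unique2[symmetric])
  moreover have "fps_of_poly [:1, -1:] * f = f - fps_X * f"
    by (simp add: fps_of_poly_pCons algebra_simps del: fps_const_neg flip: fps_const_neg)
  ultimately show ?thesis
    using euler_functional_diff[OF assms X] by simp
qed

section \<open>Binomial series, and Appell's series as a value of the functional\<close>

text \<open>The expansion of \<open>(1 - x t)^(-\<beta>)\<close> in powers of
  \<open>t\<close>.\<close>

definition binom_fps :: "complex \<Rightarrow> complex \<Rightarrow> complex fps" where
  "binom_fps \<beta> x = Abs_fps (\<lambda>m. pochhammer \<beta> m / fact m * x ^ m)"

lemma fps_nth_binom_fps: "fps_nth (binom_fps \<beta> x) m = pochhammer \<beta> m / fact m * x ^ m"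
  by (simp add: binom_fps_def)

lemma pochhammer_over_fact: "pochhammer \<beta> m / fact m = (-1) ^ m * ((- \<beta> :: 'a :: field_char_0) gchoose m)"
  by (simp add: gbinomial_pochhammer flip: power_mult_distrib)

lemma binomial_series_neg:
  fixes z :: complex
  assumes "norm z < 1"
  shows "(\<lambda>N. pochhammer \<beta> N / fact N * z ^ N) sums ((1 - z) powr - \<beta>)"
proof -
  have "pochhammer \<beta> N / fact N * z ^ N = (- \<beta> gchoose N) * (- z) ^ N" for N
    unfolding pochhammer_over_fact power_minus[of z] by (simp only: mult_ac)
  then show ?thesis
    using gen_binomial_complex[of "- z" "- \<beta>"] assms by simp
qed

lemma conv_radius_binom_fps:
  assumes "norm x < 1"
  shows "fps_conv_radius (binom_fps \<beta> x) > 1"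
proof -
  \<comment> \<open>This choice gives both \<open>r > 1\<close> and \<open>norm x * r < 1\<close>,
    including the case \<open>x = 0\<close>.\<close>
  define r where "r = 2 / (1 + norm x)"
  have n: "1 + norm x > 0" by (smt (verit) norm_ge_zero)
  have r: "r > 1" "norm x * r < 1"
    using assms n by (auto simp: r_def field_simps)
  have "summable (\<lambda>m. pochhammer \<beta> m / fact m * (x * of_real r) ^ m)"
    using binomial_series_neg[of "x * of_real r" \<beta>] r by (auto simp: norm_mult sums_iff)
  also have "(\<lambda>m. pochhammer \<beta> m / fact m * (x * of_real r) ^ m) =
      (\<lambda>m. fps_nth (binom_fps \<beta> x) m * of_real r ^ m)"
    by (simp add: fps_nth_binom_fps power_mult_distrib mult.assoc)
  finally have "ereal (norm (complex_of_real r)) \<le> fps_conv_radius (binom_fps \<beta> x)"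
    unfolding fps_conv_radius_def by (rule conv_radius_geI)
  with r show ?thesis
    by (auto simp: one_ereal_def intro: less_le_trans[of _ "ereal r"])
qed

lemma fps_deriv_binom_fps: "fps_deriv (binom_fps \<beta> x) = fps_const (\<beta> * x) * binom_fps (\<beta> + 1) x"
  by (rule fps_ext) (simp add: fps_nth_binom_fps pochhammer_rec divide_simps of_nat_neq_0 del: of_nat_Suc)

text \<open>This lets binomial factors whose exponents differ by integers be written as polynomials
  times one common series.\<close>

lemma binom_fps_rec: "binom_fps \<beta> x = fps_of_poly [:1, -x:] * binom_fps (\<beta> + 1) x"
proof (rule fps_ext)
  fix m
  have "fps_nth (fps_of_poly [:1, -x:] * binom_fps (\<beta> + 1) x) m =
    fps_nth (binom_fps (\<beta> + 1) x) m - x * fps_nth (fps_X * binom_fps (\<beta> + 1) x) m"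
    by (simp add: fps_of_poly_pCons algebra_simps)
  also have "\<dots> = fps_nth (binom_fps \<beta> x) m"
  proof (cases m)
    case (Suc k)
    have "pochhammer \<beta> (Suc k) = \<beta> * pochhammer (\<beta> + 1) k"
      by (rule pochhammer_rec)
    then show ?thesis using Suc
      by (simp add: fps_nth_binom_fps pochhammer_Suc[of "\<beta> + 1"] divide_simps of_nat_neq_0
          del: pochhammer_Suc of_nat_Suc)
        (simp add: algebra_simps)
  qed (simp add: fps_nth_binom_fps)
  finally show "fps_nth (binom_fps \<beta> x) m = fps_nth (fps_of_poly [:1, -x:] * binom_fps (\<beta> + 1) x) m" ..
qed

lemma bij_betw_antidiagonals:
  "bij_betw (\<lambda>(k, m). (m, k - m)) (SIGMA k:UNIV. {..k}) (UNIV :: (nat \<times> nat) set)"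
  by (rule bij_betwI[where g = "\<lambda>(m, n). (m + n, m)"]) auto

text \<open>The quotient \<open>(\<alpha>, m + n) / (\<gamma>, m + n)\<close> depends on
  \<open>m + n\<close> alone, so summing along antidiagonals leaves the coefficients of a Cauchy
  product. Absolute summability of the double series justifies the regrouping.\<close>

lemma appell_F1_eq_euler_functional:
  assumes "\<alpha> \<notin> \<int>\<^sub>\<le>\<^sub>0" "\<gamma> \<notin> \<int>\<^sub>\<le>\<^sub>0" "norm x < 1" "norm y < 1"
  shows "appell_F1 \<alpha> \<beta>1 \<beta>2 \<gamma> x y = euler_functional \<alpha> \<gamma> (binom_fps \<beta>1 x * binom_fps \<beta>2 y)"
proof -
  let ?w = "euler_weight \<alpha> \<gamma>"
  define b c where "b = fps_nth (binom_fps \<beta>1 x)" and "c = fps_nth (binom_fps \<beta>2 y)"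
  define t where "t = (\<lambda>(m, n). ?w (m + n) * (b m * c n))"
  obtain r1 where r1: "r1 > 1" "\<And>s. 0 \<le> s \<Longrightarrow> s \<le> r1 \<Longrightarrow> summable (\<lambda>k. norm (b k) * s ^ k)"
    using conv_radius_gt_1_obtain[OF conv_radius_binom_fps[OF assms(3)]] unfolding b_def by blast
  obtain r2 where r2: "r2 > 1" "\<And>s. 0 \<le> s \<Longrightarrow> s \<le> r2 \<Longrightarrow> summable (\<lambda>k. norm (c k) * s ^ k)"
    using conv_radius_gt_1_obtain[OF conv_radius_binom_fps[OF assms(4)]] unfolding c_def by blast
  \<comment> \<open>With one radius for both factors, the bound \<open>B * r ^ (m + n)\<close> on
    the weight splits, and the double series is dominated by a product of two convergent
    series.\<close>
  define r where "r = min r1 r2"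
  have r: "r > 1" "summable (\<lambda>k. norm (b k) * r ^ k)" "summable (\<lambda>k. norm (c k) * r ^ k)"
    using r1 r2 by (auto simp: r_def)
  obtain B where B: "B > 0" "\<And>k. norm (?w k) \<le> B * r ^ k"
    using euler_weight_bound[OF assms(1,2) r(1)] by blast
  have "(\<lambda>k. norm (b k) * r ^ k) summable_on UNIV" "(\<lambda>k. norm (c k) * r ^ k) summable_on UNIV"
    using r by (auto intro!: norm_summable_imp_summable_on simp: norm_mult)
  then have "(\<lambda>(m, n). (norm (b m) * r ^ m) * (norm (c n) * r ^ n)) summable_on UNIV \<times> UNIV"
    using r by (intro summable_on_SigmaI[where g = "\<lambda>m. (norm (b m) * r ^ m) * (\<Sum>\<^sub>\<infinity>n. norm (c n) * r ^ n)"])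
      (auto intro!: has_sum_cmult_right summable_on_cmult_left)
  then have "(\<lambda>p. B * (\<lambda>(m, n). (norm (b m) * r ^ m) * (norm (c n) * r ^ n)) p) summable_on UNIV"
    by (intro summable_on_cmult_right) simp
  then have "(\<lambda>p. norm (t p)) summable_on UNIV"
  proof (rule summable_on_comparison_test)
    fix p :: "nat \<times> nat"
    obtain m n where p: "p = (m, n)" by (cases p)
    have "norm (?w (m + n)) * norm (b m * c n) \<le> B * r ^ (m + n) * norm (b m * c n)"
      by (intro mult_right_mono B) auto
    then show "norm (t p) \<le> B * (\<lambda>(m, n). (norm (b m) * r ^ m) * (norm (c n) * r ^ n)) p"
      by (simp add: p t_def norm_mult power_add mult_ac)
  qed auto
  then have "(t has_sum infsum t UNIV) UNIV"
    by (rule has_sum_infsum[OF abs_summable_summable])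
  then have "((\<lambda>(k, m). t (m, k - m)) has_sum infsum t UNIV) (SIGMA k:UNIV. {..k})"
    by (subst (asm) has_sum_reindex_bij_betw[OF bij_betw_antidiagonals, symmetric])
      (simp add: case_prod_unfold)
  then have "((\<lambda>k. \<Sum>m\<le>k. t (m, k - m)) has_sum infsum t UNIV) UNIV"
    by (rule has_sum_SigmaD) (auto intro: has_sum_finite)
  then have "(\<lambda>k. \<Sum>m\<le>k. t (m, k - m)) sums infsum t UNIV"
    by (rule has_sum_imp_sums)
  also have "(\<lambda>k. \<Sum>m\<le>k. t (m, k - m)) = (\<lambda>k. ?w k * fps_nth (binom_fps \<beta>1 x * binom_fps \<beta>2 y) k)"
    by (auto simp: t_def b_def c_def fps_mult_nth sum_distrib_left atLeast0AtMost intro!: sum.cong)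
  finally have "infsum t UNIV = euler_functional \<alpha> \<gamma> (binom_fps \<beta>1 x * binom_fps \<beta>2 y)"
    by (simp add: euler_functional_def sums_iff)
  moreover have "appell_F1 \<alpha> \<beta>1 \<beta>2 \<gamma> x y = infsum t UNIV"
    unfolding appell_F1_def
    by (intro infsum_cong)
      (auto simp: t_def b_def c_def fps_nth_binom_fps euler_weight_def pochhammer_fact mult_ac)
  ultimately show ?thesis by simp
qed

section \<open>The recurrence between a and a + 1\<close>

definition appell_special :: "complex \<Rightarrow> complex" where
  "appell_special a = appell_F1 (1/2) (2 * a) (3 * a - 1/2) (3 * a + 1/2) (1/5) (- 4/5)"

lemma half_not_nonpos_Int: "(1/2 :: complex) \<notin> \<int>\<^sub>\<le>\<^sub>0"
  by (auto elim!: nonpos_Ints_cases simp: complex_eq_iff)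

text \<open>
  With \<open>v = 5\<^sup>5 (1 - t)\<^sup>3 / ((5 - t)\<^sup>2 (5 + 4 t)\<^sup>3)\<close> the numerator of \<open>1 - v\<close> is
  \<open>t (8 t\<^sup>2 - 25 t + 125)\<^sup>2\<close>, which is where \<open>Q\<close> comes from. The identity is the derivative of
  \<open>v\<^sup>a (1 - v)\<^bsup>1/2\<^esup>\<close> in \<open>t\<close>, up to a constant and after division by the common non-polynomial factor.
\<close>
lemma certificate_identity:
  fixes a :: complex
  defines "A \<equiv> [:1, -1/5:]" and "B \<equiv> [:1, 4/5:]" and "Q \<equiv> [:1, -1/5, 8/125:]"
  shows "[:1/2, -(3 * a + 1/2):] * (Q * (A * B)) +
      [:0, 1, -1:] * (pderiv Q * (A * B) + Q * (smult ((2 * a + 1) * (1/5)) B + smult ((3 * a + 3/2) * (-4/5)) A)) =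
    smult (a + 1/2) ([:1, -1:] ^ 3) - smult a (A\<^sup>2 * B ^ 3)"
  unfolding A_def B_def Q_def
  by (simp add: power2_eq_square power3_eq_cube pderiv_pCons) (simp add: field_simps)

text \<open>The functional kills the total derivative built from \<open>p\<close>. By the
  certificate this derivative is a combination of the integrand at \<open>a\<close> and of
  \<open>(1 - t)^3 G\<close>, and absorbing \<open>(1 - t)^3\<close> into the weight turns the
  latter into the value at \<open>a + 1\<close>.\<close>

lemma appell_special_rec:
  assumes "3 * a + 1/2 \<notin> \<int>\<^sub>\<le>\<^sub>0" "a \<noteq> 0"
  shows "appell_special a = (a + 1/3) * (a + 2/3) / ((a + 1/6) * (a + 5/6)) * appell_special (a + 1)"
proof -
  define A B Q where "A = [:1, -1/5 :: complex:]" and "B = [:1, 4/5 :: complex:]"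
    and "Q = [:1, -1/5, 8/125 :: complex:]"
  define L where "L = euler_functional (1/2)"
  define \<gamma> where "\<gamma> = 3 * a + 1/2"
  \<comment> \<open>The integrand belonging to \<open>a + 1\<close>; every other series below is a
    polynomial multiple of it.\<close>
  define G where "G = binom_fps (2 * a + 2) (1/5) * binom_fps (3 * a + 5/2) (-4/5)"
  have \<gamma>: "\<gamma> \<notin> \<int>\<^sub>\<le>\<^sub>0" "\<gamma> + 1 \<notin> \<int>\<^sub>\<le>\<^sub>0" "\<gamma> + 2 \<notin> \<int>\<^sub>\<le>\<^sub>0" "\<gamma> + 3 \<notin> \<int>\<^sub>\<le>\<^sub>0"
    using assms(1) plus_one_in_nonpos_Ints_imp[of \<gamma>] plus_one_in_nonpos_Ints_imp[of "\<gamma> + 1"]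
      plus_one_in_nonpos_Ints_imp[of "\<gamma> + 2"] by (auto simp: \<gamma>_def add.assoc)
  then have \<gamma>0: "\<gamma> \<noteq> 0" "\<gamma> + 1 \<noteq> 0" "\<gamma> + 2 \<noteq> 0"
    by force+
  have G: "fps_conv_radius G > 1"
    unfolding G_def by (intro conv_radius_gt_1_intros conv_radius_binom_fps) (auto simp: norm_divide)
  have poly: "fps_conv_radius (fps_of_poly p * f) > 1" if "fps_conv_radius f > 1" for p and f :: "complex fps"
    using that by (intro conv_radius_gt_1_intros) simp_all
  have rec1: "binom_fps (2 * a + 1) (1/5) = fps_of_poly A * binom_fps (2 * a + 2) (1/5)"
    using binom_fps_rec[of "2 * a + 1" "1/5"] by (simp add: A_def add.assoc)
  have rec2: "binom_fps (2 * a) (1/5) = fps_of_poly (A\<^sup>2) * binom_fps (2 * a + 2) (1/5)"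
    using binom_fps_rec[of "2 * a" "1/5"]
    by (simp add: A_def rec1 fps_of_poly_mult power2_eq_square mult.assoc)
  have rec3: "binom_fps (3 * a + 3/2) (-4/5) = fps_of_poly B * binom_fps (3 * a + 5/2) (-4/5)"
    using binom_fps_rec[of "3 * a + 3/2" "-4/5"] by (simp add: B_def add.assoc)
  have rec4: "binom_fps (3 * a - 1/2) (-4/5) = fps_of_poly (B ^ 3) * binom_fps (3 * a + 5/2) (-4/5)"
  proof -
    have "binom_fps (3 * a - 1/2) (-4/5) = fps_of_poly B * binom_fps (3 * a + 1/2) (-4/5)"
      using binom_fps_rec[of "3 * a - 1/2" "-4/5"] by (simp add: B_def algebra_simps)
    also have "binom_fps (3 * a + 1/2) (-4/5) = fps_of_poly B * binom_fps (3 * a + 3/2) (-4/5)"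
      using binom_fps_rec[of "3 * a + 1/2" "-4/5"] by (simp add: B_def add.assoc)
    finally show ?thesis
      by (simp only: rec3 fps_of_poly_mult power3_eq_cube mult.assoc)
  qed
  \<comment> \<open>Chosen so that \<open>t^(1/2) (1 - t)^(3 a) p\<close> is a constant multiple of
    \<open>v^a (1 - v)^(1/2)\<close>.\<close>
  define p where "p = fps_of_poly Q * (binom_fps (2 * a + 1) (1/5) * binom_fps (3 * a + 3/2) (-4/5))"
  have "fps_deriv p = fps_of_poly (pderiv Q * (A * B) +
      Q * (smult ((2 * a + 1) * (1/5)) B + smult ((3 * a + 3/2) * (-4/5)) A)) * G"
  proof -
    define c1 c2 where "c1 = (2 * a + 1) * (1/5)" and "c2 = (3 * a + 3/2) * (-4/5)"
    define b1 b2 where "b1 = binom_fps (2 * a + 2) (1/5)" and "b2 = binom_fps (3 * a + 5/2) (-4/5)"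
    have "fps_deriv (binom_fps (2 * a + 1) (1/5)) = fps_const c1 * b1"
      by (simp add: fps_deriv_binom_fps c1_def b1_def add.assoc)
    moreover have "fps_deriv (binom_fps (3 * a + 3/2) (-4/5)) = fps_const c2 * b2"
      using fps_deriv_binom_fps[of "3 * a + 3/2" "-4/5"] by (simp add: c2_def b2_def add.assoc)
    ultimately have "fps_deriv p = fps_of_poly (pderiv Q * (A * B) + Q * (smult c1 B + smult c2 A)) * (b1 * b2)"
      unfolding p_def fps_deriv_mult
      by (simp only: rec1[folded b1_def] rec3[folded b2_def] fps_of_poly_pderiv fps_of_poly_mult
          fps_of_poly_add fps_of_poly_smult) (simp only: algebra_simps)
    then show ?thesis by (simp only: c1_def c2_def b1_def b2_def G_def)
  qed
  moreover have "p = fps_of_poly (Q * (A * B)) * G"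
    unfolding p_def rec1 rec3 G_def fps_of_poly_mult by (simp only: mult_ac)
  ultimately have "fps_of_poly [:1/2, -\<gamma>:] * p + fps_of_poly [:0, 1, -1:] * fps_deriv p =
      fps_of_poly ([:1/2, -\<gamma>:] * (Q * (A * B)) + [:0, 1, -1:] * (pderiv Q * (A * B) +
        Q * (smult ((2 * a + 1) * (1/5)) B + smult ((3 * a + 3/2) * (-4/5)) A))) * G"
    by (simp only: fps_of_poly_mult fps_of_poly_add distrib_right mult.assoc)
  also have "\<dots> = fps_const (a + 1/2) * (fps_of_poly ([:1, -1:] ^ 3) * G) - fps_const a * (fps_of_poly (A\<^sup>2 * B ^ 3) * G)"
    unfolding \<gamma>_def certificate_identity[folded A_def B_def Q_def]
    by (simp only: fps_of_poly_diff fps_of_poly_smult left_diff_distrib mult.assoc)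
  also have "fps_of_poly (A\<^sup>2 * B ^ 3) * G = binom_fps (2 * a) (1/5) * binom_fps (3 * a - 1/2) (-4/5)"
    unfolding rec2 rec4 G_def fps_of_poly_mult by (simp only: mult_ac)
  finally have "fps_of_poly [:1/2, -\<gamma>:] * p + fps_of_poly [:0, 1, -1:] * fps_deriv p =
    fps_const (a + 1/2) * (fps_of_poly ([:1, -1:] ^ 3) * G) -
    fps_const a * (binom_fps (2 * a) (1/5) * binom_fps (3 * a - 1/2) (-4/5))" .
  moreover have conv: "fps_conv_radius p > 1"
    "fps_conv_radius (binom_fps (2 * a) (1/5) * binom_fps (3 * a - 1/2) (-4/5)) > 1"
    unfolding p_def
    by (intro poly conv_radius_gt_1_intros conv_radius_binom_fps; simp add: norm_divide)+
  moreover have "L \<gamma> (fps_of_poly [:1/2, -\<gamma>:] * p + fps_of_poly [:0, 1, -1:] * fps_deriv p) = 0"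
    unfolding L_def by (rule euler_functional_total_derivative[OF half_not_nonpos_Int \<gamma>(1) conv(1)])
  ultimately have "(a + 1/2) * L \<gamma> (fps_of_poly ([:1, -1:] ^ 3) * G) =
      a * L \<gamma> (binom_fps (2 * a) (1/5) * binom_fps (3 * a - 1/2) (-4/5))"
    using half_not_nonpos_Int \<gamma>(1) G poly conv
    by (simp add: L_def euler_functional_diff euler_functional_cmult conv_radius_gt_1_intros)
  moreover have "L \<gamma> (binom_fps (2 * a) (1/5) * binom_fps (3 * a - 1/2) (-4/5)) = appell_special a"
    unfolding appell_special_def L_def \<gamma>_def
    by (subst appell_F1_eq_euler_functional) (use assms half_not_nonpos_Int in \<open>auto simp: norm_divide\<close>)
  moreover have "L (\<gamma> + 3) G = appell_special (a + 1)"
    unfolding appell_special_def L_def \<gamma>_def G_def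
    by (subst appell_F1_eq_euler_functional)
      (use \<gamma>(4) half_not_nonpos_Int in \<open>auto simp: norm_divide \<gamma>_def algebra_simps\<close>)
  \<comment> \<open>Each of the three factors \<open>1 - t\<close> raises the parameter by one, from
    \<gamma> to \<open>\<gamma> + 3\<close>, which is the third parameter at
    \<open>a + 1\<close>.\<close>
  moreover have "L \<gamma> (fps_of_poly ([:1, -1:] ^ 3) * G) =
      (3 * a) / \<gamma> * ((3 * a + 1) / (\<gamma> + 1) * ((3 * a + 2) / (\<gamma> + 2) * L (\<gamma> + 3) G))"
  proof -
    let ?T = "fps_of_poly [:1, -1 :: complex:]"
    have "fps_of_poly ([:1, -1:] ^ 3) * G = ?T * (?T * (?T * G))"
      by (simp only: power3_eq_cube fps_of_poly_mult mult.assoc)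
    moreover have "L \<gamma> (?T * (?T * (?T * G))) = (\<gamma> - 1/2) / \<gamma> * L (\<gamma> + 1) (?T * (?T * G))"
      "L (\<gamma> + 1) (?T * (?T * G)) = (\<gamma> + 1 - 1/2) / (\<gamma> + 1) * L (\<gamma> + 1 + 1) (?T * G)"
      "L (\<gamma> + 2) (?T * G) = (\<gamma> + 2 - 1/2) / (\<gamma> + 2) * L (\<gamma> + 2 + 1) G"
      unfolding L_def by (intro euler_functional_one_minus_X half_not_nonpos_Int \<gamma> poly G)+
    moreover have "\<gamma> + 1 + 1 = \<gamma> + 2" "\<gamma> + 2 + 1 = \<gamma> + 3" "\<gamma> - 1/2 = 3 * a"
      "\<gamma> + 1 - 1/2 = 3 * a + 1" "\<gamma> + 2 - 1/2 = 3 * a + 2"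
      by (simp_all add: \<gamma>_def)
    ultimately show ?thesis by (simp only:)
  qed
  ultimately have "a * appell_special a = (a + 1/2) *
      ((3 * a) / \<gamma> * ((3 * a + 1) / (\<gamma> + 1) * ((3 * a + 2) / (\<gamma> + 2) * appell_special (a + 1))))"
    by simp
  \<comment> \<open>In this form \<open>\<gamma> + 1\<close> cancels against the factor
    \<open>a + 1/2\<close> from the certificate, and the powers of 3 cancel as well.\<close>
  moreover have \<gamma>_eq: "\<gamma> = 3 * (a + 1/6)" "\<gamma> + 1 = 3 * (a + 1/2)" "\<gamma> + 2 = 3 * (a + 5/6)"
    by (simp_all add: \<gamma>_def)
  moreover have "a + 1/2 \<noteq> 0"
    using \<gamma>0(2) \<gamma>_eq(2) by (metis mult_zero_right)
  moreover have "3 * a + 1 = 3 * (a + 1/3)" "3 * a + 2 = 3 * (a + 2/3)" by simp_all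
  moreover have "h * (3 * a / (3 * u) * (3 * s / (3 * h) * (3 * t / (3 * v) * F))) = a * (s * t / (u * v) * F)"
    if "h \<noteq> 0" for h u v s t F :: complex
    using that by simp
  ultimately have "a * appell_special a =
      a * ((a + 1/3) * (a + 2/3) / ((a + 1/6) * (a + 5/6)) * appell_special (a + 1))"
    by (simp only: simp_thms)
  \<comment> \<open>One factor \<open>a\<close> comes from the certificate, the other from
    \<open>\<gamma> - 1/2 = 3 * a\<close> at the first absorption; cancelling them requires
    \<open>a \<noteq> 0\<close>.\<close>
  then show ?thesis using assms(2) by (simp only: mult_cancel_left simp_thms)
qed

section \<open>Domination and termwise limits along a + n\<close>

lemma norm_pochhammer_le_pochhammer:
  fixes u v :: "'a :: real_normed_field"
  assumes "\<kappa> \<ge> 0" "\<And>j. j < m \<Longrightarrow> norm (u + of_nat j) \<le> \<kappa> * norm (v + of_nat j)"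
  shows "norm (pochhammer u m) \<le> \<kappa> ^ m * norm (pochhammer v m)"
  using assms(2)
proof (induction m)
  case (Suc m)
  have "norm (pochhammer u (Suc m)) = norm (pochhammer u m) * norm (u + of_nat m)"
    by (simp add: pochhammer_Suc norm_mult)
  also have "\<dots> \<le> (\<kappa> ^ m * norm (pochhammer v m)) * (\<kappa> * norm (v + of_nat m))"
    using Suc assms(1) by (intro mult_mono) auto
  also have "\<dots> = \<kappa> ^ Suc m * norm (pochhammer v (Suc m))"
    by (simp add: pochhammer_Suc norm_mult mult_ac)
  finally show ?case .
qed auto

text \<open>Collecting by total degree leaves a single series whose terms can be bounded and passed
  to the limit for each \<open>N\<close> as \<open>b\<close> varies.\<close>

definition appell_special_coeff :: "complex \<Rightarrow> nat \<Rightarrow> complex" where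
  "appell_special_coeff b N = euler_weight (1/2) (3 * b + 1/2) N *
     fps_nth (binom_fps (2 * b) (1/5) * binom_fps (3 * b - 1/2) (- 4/5)) N"

lemma appell_special_coeff_eq:
  "appell_special_coeff b N = (\<Sum>m\<le>N. pochhammer (1/2) N / (fact m * fact (N - m)) * (1/5) ^ m * (- 4/5) ^ (N - m) *
     (pochhammer (2 * b) m * pochhammer (3 * b - 1/2) (N - m) / pochhammer (3 * b + 1/2) N))"
  by (auto simp: appell_special_coeff_def euler_weight_def fps_mult_nth fps_nth_binom_fps
      sum_distrib_left atLeast0AtMost mult_ac intro!: sum.cong)

text \<open>The bound is independent of \<open>b\<close>, as dominated convergence requires. The
  Pochhammer quotient is compared factor by factor, and the binomial theorem then gives the bases
  \<open>3/20 + 4/5\<close> and \<open>2/5 + 1/10\<close>.\<close>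

lemma norm_appell_special_coeff_le:
  assumes "Re b \<ge> 1" "norm b \<le> 9/8 * Re b"
  shows "norm (appell_special_coeff b N) \<le> (19/20) ^ N + (1/2) ^ N"
proof -
  have half: "norm (pochhammer (1/2 :: complex) n) \<le> fact n" for n
  proof -
    have "norm (pochhammer (1/2 :: complex) n) \<le> 1 ^ n * norm (pochhammer (1 :: complex) n)"
    proof (rule norm_pochhammer_le_pochhammer)
      fix j :: nat
      have "norm (1/2 + of_nat j :: complex) = norm (of_real (1/2 + real j) :: complex)" by simp
      also have "\<dots> \<le> norm (of_real (1 + real j) :: complex)" by (simp only: norm_of_real)
      finally show "norm (1/2 + of_nat j :: complex) \<le> 1 * norm (1 + of_nat j :: complex)" by simp
    qed simp
    also have "pochhammer (1 :: complex) n = of_nat (fact n)"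
      by (simp only: pochhammer_fact[symmetric] of_nat_fact)
    finally show ?thesis by (simp only: norm_of_nat) simp
  qed
  have "norm (appell_special_coeff b N) \<le>
      (\<Sum>m\<le>N. real (N choose m) * (3/20) ^ m * (4/5) ^ (N - m) + real (N choose m) * (2/5) ^ m * (1/10) ^ (N - m))"
    unfolding appell_special_coeff_eq
  proof (rule sum_norm_le)
    fix m assume "m \<in> {..N}"
    define k where "k = N - m"
    have N: "N = k + m" and m: "m \<le> N" using \<open>m \<in> {..N}\<close> by (auto simp: k_def)
    have pos: "pochhammer (3 * b + 1/2) N \<noteq> 0"
    proof
      assume "pochhammer (3 * b + 1/2) N = 0"
      then obtain j where "3 * b + 1/2 = - of_nat j" by (auto simp: pochhammer_eq_0_iff)
      from arg_cong[OF this, of Re] assms show False by simp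
    qed
    have lower: "norm (3 * b + 1/2 + of_nat i) \<ge> 3 * Re b + real i" for i
      using complex_Re_le_cmod[of "3 * b + 1/2 + of_nat i"] by simp
    have upper: "norm (2 * b + of_nat j) \<le> 9/4 * Re b + real j" for j
      using norm_triangle_ineq[of "2 * b" "of_nat j"] assms by (simp add: norm_mult)
    \<comment> \<open>Since \<open>norm (2 * b) \<le> 9/4 * Re b = 3/4 * (3 * Re b)\<close>, the
      ratio 3/4 works for the j-th factor as long as \<open>j \<le> 3 * k\<close>; otherwise the
      trivial ratio 1 is used.\<close>
    define \<kappa> :: real where "\<kappa> = (if m \<le> 3 * k then 3/4 else 1)"
    have "norm (pochhammer (3 * b - 1/2) k) \<le> 1 ^ k * norm (pochhammer (3 * b + 1/2) k)"
    proof (rule norm_pochhammer_le_pochhammer)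
      fix j :: nat
      have "(3 * Re b - 1/2 + j)\<^sup>2 \<le> (3 * Re b + 1/2 + j)\<^sup>2"
        using assms by (intro power_mono) auto
      then show "norm (3 * b - 1/2 + of_nat j) \<le> 1 * norm (3 * b + 1/2 + of_nat j)"
        by (simp add: cmod_def)
    qed simp
    moreover have "norm (pochhammer (2 * b) m) \<le> \<kappa> ^ m * norm (pochhammer (3 * b + 1/2 + of_nat k) m)"
    proof (rule norm_pochhammer_le_pochhammer)
      fix j assume j: "j < m"
      have "9/4 * Re b + real j \<le> \<kappa> * (3 * Re b + real (k + j))"
        using assms j by (auto simp: \<kappa>_def)
      also have "\<dots> \<le> \<kappa> * norm (3 * b + 1/2 + of_nat (k + j))"
        by (intro mult_left_mono lower) (auto simp: \<kappa>_def)
      finally show "norm (2 * b + of_nat j) \<le> \<kappa> * norm (3 * b + 1/2 + of_nat k + of_nat j)"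
        using upper[of j] by (simp add: add.assoc)
    qed (auto simp: \<kappa>_def)
    ultimately have "norm (pochhammer (3 * b - 1/2) k) * norm (pochhammer (2 * b) m) \<le>
        norm (pochhammer (3 * b + 1/2) k) * (\<kappa> ^ m * norm (pochhammer (3 * b + 1/2 + of_nat k) m))"
      by (intro mult_mono) auto
    also have "\<dots> = \<kappa> ^ m * norm (pochhammer (3 * b + 1/2) N)"
      by (simp add: N pochhammer_product' norm_mult)
    finally have ratio: "norm (pochhammer (2 * b) m * pochhammer (3 * b - 1/2) k / pochhammer (3 * b + 1/2) N) \<le> \<kappa> ^ m"
      using pos by (simp add: norm_mult norm_divide divide_simps mult_ac)
    have "norm (pochhammer (1/2 :: complex) N / (fact m * fact k)) \<le> fact N / (fact m * fact k)"
      using half[of N] by (simp add: norm_divide norm_mult divide_simps)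
    also have "\<dots> = real (N choose m)"
      using m by (simp add: binomial_fact k_def)
    finally have choose: "norm (pochhammer (1/2 :: complex) N / (fact m * fact k)) \<le> real (N choose m)" .
    \<comment> \<open>for \<open>m > 3 k\<close> the trivial ratio bound suffices after inserting \<open>1 \<le> 2\<^sup>m / 8\<^sup>k\<close>; without this
      the binomial sum would be \<open>(1/5 + 4/5)\<^sup>N\<close>\<close>
    have weights: "(\<kappa>/5) ^ m * (4/5) ^ k \<le> (3/20) ^ m * (4/5) ^ k + (2/5) ^ m * (1/10) ^ k"
    proof (cases "m \<le> 3 * k")
      case False
      have "(8 :: real) ^ k = 2 ^ (3 * k)"
        by (simp add: power_mult)
      also have "\<dots> \<le> 2 ^ m"
        using False by (intro power_increasing) auto
      finally have "((1/5) ^ m * (1/10) ^ k) * 8 ^ k \<le> ((1/5) ^ m * (1/10) ^ k) * (2 :: real) ^ m"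
        by (intro mult_left_mono) auto
      moreover have "(4/5 :: real) ^ k = (1/10) ^ k * 8 ^ k" "(2/5 :: real) ^ m = (1/5) ^ m * 2 ^ m"
        by (simp_all flip: power_mult_distrib)
      ultimately have "(1/5) ^ m * (4/5) ^ k \<le> (2/5 :: real) ^ m * (1/10) ^ k"
        by (simp only: mult_ac)
      then show ?thesis using False by (simp add: \<kappa>_def add_increasing)
    qed (auto simp: \<kappa>_def)
    have "norm (pochhammer (1/2) N / (fact m * fact k) * (1/5) ^ m * (- 4/5) ^ k *
        (pochhammer (2 * b) m * pochhammer (3 * b - 1/2) k / pochhammer (3 * b + 1/2) N)) =
      norm (pochhammer (1/2 :: complex) N / (fact m * fact k)) * ((1/5) ^ m * (4/5) ^ k) *
        norm (pochhammer (2 * b) m * pochhammer (3 * b - 1/2) k / pochhammer (3 * b + 1/2) N)"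
      by (simp add: norm_mult norm_divide norm_power)
    also have "\<dots> \<le> real (N choose m) * ((1/5) ^ m * (4/5) ^ k) * \<kappa> ^ m"
      by (intro mult_mono choose ratio) auto
    also have "\<dots> = real (N choose m) * ((\<kappa>/5) ^ m * (4/5) ^ k)"
      by (simp add: power_divide)
    also have "\<dots> \<le> real (N choose m) * ((3/20) ^ m * (4/5) ^ k + (2/5) ^ m * (1/10) ^ k)"
      by (intro mult_left_mono weights) auto
    finally show "norm (pochhammer (1/2) N / (fact m * fact (N - m)) * (1/5) ^ m * (- 4/5) ^ (N - m) *
        (pochhammer (2 * b) m * pochhammer (3 * b - 1/2) (N - m) / pochhammer (3 * b + 1/2) N)) \<le>
        real (N choose m) * (3/20) ^ m * (4/5) ^ (N - m) + real (N choose m) * (2/5) ^ m * (1/10) ^ (N - m)"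
      by (simp only: k_def distrib_left mult.assoc)
  qed
  also have "\<dots> = (3/20 + 4/5) ^ N + (2/5 + 1/10) ^ N"
    unfolding binomial_ring sum.distrib by simp
  finally show ?thesis by simp
qed

lemma pochhammer_linear_asymp:
  fixes c d :: complex
  shows "((\<lambda>b. pochhammer (c * b + d) m / b ^ m) \<longlongrightarrow> c ^ m) at_infinity"
proof (induction m)
  case (Suc m)
  have "((\<lambda>b. c + (d + of_nat m) * inverse b) \<longlongrightarrow> c + (d + of_nat m) * 0) at_infinity"
    by (intro tendsto_intros tendsto_inverse_0)
  moreover have "\<forall>\<^sub>F b in at_infinity. c + (d + of_nat m) * inverse b = (c * b + d + of_nat m) / b"
    using eventually_not_equal_at_infinity[of 0] by eventually_elim (auto simp: field_simps)
  ultimately have "((\<lambda>b. (c * b + d + of_nat m) / b) \<longlongrightarrow> c) at_infinity"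
    by (auto elim: Lim_transform_eventually)
  from tendsto_mult[OF Suc this] show ?case
    by (simp add: pochhammer_Suc mult_ac)
qed simp

text \<open>The powers of \<open>b\<close> cancel and leave
  \<open>2^m 3^(N-m) / 3^N = (2/3)^m\<close>; the finite sum is then the binomial expansion of
  \<open>(2/15 - 4/5)^N\<close>.\<close>

lemma appell_special_coeff_tendsto:
  "((\<lambda>b. appell_special_coeff b N) \<longlongrightarrow> pochhammer (1/2) N / fact N * (- 2/3) ^ N) at_infinity"
proof -
  have ratio: "((\<lambda>b. pochhammer (2 * b) m * pochhammer (3 * b - 1/2) (N - m) / pochhammer (3 * b + 1/2) N)
      \<longlongrightarrow> (2/3 :: complex) ^ m) at_infinity" if m: "m \<le> N" for m
  proof -
    have "((\<lambda>b. (pochhammer (2 * b + 0) m / b ^ m) * (pochhammer (3 * b + (- 1/2)) (N - m) / b ^ (N - m)) /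
        (pochhammer (3 * b + 1/2) N / b ^ N)) \<longlongrightarrow> 2 ^ m * 3 ^ (N - m) / (3 :: complex) ^ N) at_infinity"
      by (intro tendsto_intros pochhammer_linear_asymp) auto
    moreover have "\<forall>\<^sub>F b in at_infinity. (pochhammer (2 * b + 0) m / b ^ m) *
        (pochhammer (3 * b + (- 1/2)) (N - m) / b ^ (N - m)) / (pochhammer (3 * b + 1/2) N / b ^ N) =
        pochhammer (2 * b) m * pochhammer (3 * b - 1/2) (N - m) / pochhammer (3 * b + 1/2 :: complex) N"
      using eventually_not_equal_at_infinity[of 0]
    proof eventually_elim
      case (elim b)
      then have "b ^ m * b ^ (N - m) = b ^ N" "b ^ N \<noteq> 0"
        using m by (auto simp flip: power_add)
      then show ?case by (simp add: field_simps)
    qed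
    moreover have "2 ^ m * 3 ^ (N - m) / (3 :: complex) ^ N = (2/3) ^ m"
      using m by (simp add: power_diff power_divide)
    ultimately show ?thesis by (auto elim: Lim_transform_eventually)
  qed
  have "((\<lambda>b. appell_special_coeff b N) \<longlongrightarrow>
      (\<Sum>m\<le>N. pochhammer (1/2) N / (fact m * fact (N - m)) * (1/5) ^ m * (- 4/5) ^ (N - m) * (2/3) ^ m)) at_infinity"
    unfolding appell_special_coeff_eq by (intro tendsto_intros ratio) auto
  also have "(\<Sum>m\<le>N. pochhammer (1/2) N / (fact m * fact (N - m)) * (1/5) ^ m * (- 4/5) ^ (N - m) * (2/3) ^ m) =
      (\<Sum>m\<le>N. pochhammer (1/2) N / fact N * (of_nat (N choose m) * (2/15) ^ m * (- 4/5 :: complex) ^ (N - m)))"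
  proof (rule sum.cong)
    fix m assume "m \<in> {..N}"
    then have "of_nat (N choose m) = (fact N / (fact m * fact (N - m)) :: complex)"
      by (simp add: binomial_fact)
    moreover have "(1/5) ^ m * (2/3) ^ m = (2/15 :: complex) ^ m"
      by (simp flip: power_mult_distrib)
    ultimately show "pochhammer (1/2) N / (fact m * fact (N - m)) * (1/5) ^ m * (- 4/5) ^ (N - m) * (2/3) ^ m =
        pochhammer (1/2) N / fact N * (of_nat (N choose m) * (2/15) ^ m * (- 4/5 :: complex) ^ (N - m))"
      by simp
  qed simp
  also have "\<dots> = pochhammer (1/2) N / fact N * (2/15 + (- 4/5)) ^ N"
    unfolding binomial_ring by (simp add: sum_distrib_left)
  finally show ?thesis by simp
qed

lemma appell_special_eq_suminf:
  assumes "3 * a + 1/2 \<notin> \<int>\<^sub>\<le>\<^sub>0"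
  shows "appell_special a = (\<Sum>N. appell_special_coeff a N)"
  unfolding appell_special_def appell_special_coeff_def
  by (subst appell_F1_eq_euler_functional)
    (use assms half_not_nonpos_Int in \<open>auto simp: norm_divide euler_functional_def\<close>)

lemma complex_powr_half: "0 \<le> x \<Longrightarrow> complex_of_real x powr (1/2) = complex_of_real (sqrt x)"
  using powr_of_real[of x "1/2"] by (simp add: powr_half_sqrt)

lemma suminf_pochhammer_half:
  "(\<Sum>N. pochhammer (1/2) N / fact N * (- 2/3) ^ N) = complex_of_real (sqrt (3/5))"
proof -
  have "(\<lambda>N. pochhammer (1/2) N / fact N * (- 2/3) ^ N) sums ((1 - (- 2/3)) powr - (1/2 :: complex))"
    by (rule binomial_series_neg) (simp add: norm_divide)
  also have "(1 - (- 2/3)) powr - (1/2 :: complex) = inverse (complex_of_real (5/3) powr (1/2))"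
    by (simp add: powr_minus)
  also have "\<dots> = complex_of_real (inverse (sqrt (5/3)))"
    by (subst complex_powr_half) simp_all
  also have "inverse (sqrt (5/3)) = sqrt (3/5)"
    by (simp add: real_sqrt_divide)
  finally show ?thesis by (simp add: sums_iff)
qed
lemma appell_special_tendsto:
  "(\<lambda>n. appell_special (a + of_nat n)) \<longlonglongrightarrow> complex_of_real (sqrt (3/5))"
proof -
  \<comment> \<open>The constant 17 comes from \<open>norm a + n \<le> 9/8 * (n - norm a)\<close>,
    which is equivalent to \<open>n \<ge> 17 * norm a\<close>; the extra 1 secures real part at
    least 1.\<close>
  have ev: "\<forall>\<^sub>F n in sequentially. Re (a + of_nat n) \<ge> 1 \<and> norm (a + of_nat n) \<le> 9/8 * Re (a + of_nat n)"
    using eventually_ge_at_top[of "nat \<lceil>1 + 17 * norm a\<rceil>"]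
  proof eventually_elim
    case (elim n)
    then have "real n \<ge> 1 + 17 * norm a" by linarith
    moreover have "\<bar>Re a\<bar> \<le> norm a" "norm (a + of_nat n) \<le> norm a + real n"
      using abs_Re_le_cmod norm_triangle_ineq[of a "of_nat n"] by auto
    ultimately show ?case by auto
  qed
  have "(\<lambda>n. \<Sum>N. appell_special_coeff (a + of_nat n) N) \<longlonglongrightarrow> (\<Sum>N. pochhammer (1/2) N / fact N * (- 2/3) ^ N)"
  proof (rule tannerys_theorem[THEN conjunct2, THEN conjunct2])
    show "(\<lambda>n. appell_special_coeff (a + of_nat n) N) \<longlonglongrightarrow> pochhammer (1/2) N / fact N * (- 2/3) ^ N" for N
      by (intro filterlim_compose[OF appell_special_coeff_tendsto]
          tendsto_add_filterlim_at_infinity[OF tendsto_const] tendsto_of_nat)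
    \<comment> \<open>Tannery's theorem asks for the bound eventually in the product filter; here it
      holds for every \<open>N\<close> once \<open>n\<close> is large.\<close>
    have "\<forall>\<^sub>F (N :: nat, n) in at_top \<times>\<^sub>F sequentially.
        Re (a + of_nat n) \<ge> 1 \<and> norm (a + of_nat n) \<le> 9/8 * Re (a + of_nat n)"
      using ev by (subst eventually_prod2) auto
    then show "\<forall>\<^sub>F (N, n) in at_top \<times>\<^sub>F sequentially.
        norm (appell_special_coeff (a + of_nat n) N) \<le> (19/20) ^ N + (1/2) ^ N"
      by eventually_elim (use norm_appell_special_coeff_le in \<open>auto simp del: plus_complex.simps\<close>)
    show "summable (\<lambda>N. (19/20) ^ N + (1/2 :: real) ^ N)"
      by (intro summable_add summable_geometric) auto
  qed auto
  moreover have "\<forall>\<^sub>F n in sequentially. (\<Sum>N. appell_special_coeff (a + of_nat n) N) = appell_special (a + of_nat n)"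
    using ev
  proof eventually_elim
    case (elim n)
    have "Re (3 * (a + of_nat n) + 1/2) > 0" using elim by simp
    then have "3 * (a + of_nat n) + 1/2 \<notin> \<int>\<^sub>\<le>\<^sub>0"
      by (auto elim!: nonpos_Ints_cases simp del: plus_complex.simps)
    then show ?case by (rule appell_special_eq_suminf[symmetric])
  qed
  ultimately show ?thesis
    unfolding suminf_pochhammer_half by (rule Lim_transform_eventually)
qed

section \<open>The Gamma quotient\<close>

text \<open>The entire function \<open>rGamma\<close> makes the recurrence valid also where
  \<open>a + 1/3\<close> or \<open>a + 2/3\<close> is a nonpositive integer and the quotient
  vanishes.\<close>

definition gamma_quotient :: "complex \<Rightarrow> complex" where
  "gamma_quotient a = (Gamma (a + 1/6) * Gamma (a + 5/6)) * (rGamma (a + 1/3) * rGamma (a + 2/3))"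

lemma gamma_quotient_rec:
  assumes "3 * a + 1/2 \<notin> \<int>\<^sub>\<le>\<^sub>0"
  shows "gamma_quotient a = (a + 1/3) * (a + 2/3) / ((a + 1/6) * (a + 5/6)) * gamma_quotient (a + 1)"
proof -
  have nonpos: "a + 1/6 \<notin> \<int>\<^sub>\<le>\<^sub>0" "a + 5/6 \<notin> \<int>\<^sub>\<le>\<^sub>0"
  proof -
    \<comment> \<open>A pole of either numerator factor would make \<open>3 * a + 1/2\<close> a
      nonpositive integer.\<close>
    have "3 * a + 1/2 = - of_nat (3 * n)" if "a + 1/6 = - of_nat n" for n
    proof -
      from that have "a = - of_nat n - 1/6" by (simp add: algebra_simps)
      then show ?thesis by simp
    qed
    moreover have "3 * a + 1/2 = - of_nat (3 * n + 2)" if "a + 5/6 = - of_nat n" for n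
    proof -
      from that have "a = - of_nat n - 5/6" by (simp add: algebra_simps)
      then show ?thesis by simp
    qed
    ultimately show "a + 1/6 \<notin> \<int>\<^sub>\<le>\<^sub>0" "a + 5/6 \<notin> \<int>\<^sub>\<le>\<^sub>0"
      using assms by (metis minus_of_nat_in_nonpos_Ints nonpos_Ints_cases')+
  qed
  have "Gamma (a + 1 + 1/6) = (a + 1/6) * Gamma (a + 1/6)" "Gamma (a + 1 + 5/6) = (a + 5/6) * Gamma (a + 5/6)"
    using Gamma_plus1[OF nonpos(1)] Gamma_plus1[OF nonpos(2)] by (simp_all add: add_ac)
  moreover have "rGamma (a + 1/3) = (a + 1/3) * rGamma (a + 1 + 1/3)" "rGamma (a + 2/3) = (a + 2/3) * rGamma (a + 1 + 2/3)"
    using rGamma_plus1[of "a + 1/3"] rGamma_plus1[of "a + 2/3"] by (simp_all add: add_ac)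
  moreover have "a + 1/6 \<noteq> 0" "a + 5/6 \<noteq> 0"
    using nonpos by auto
  ultimately show ?thesis
    unfolding gamma_quotient_def by (simp add: mult_ac)
qed

text \<open>Each Gamma value is the limit of its Gauss-type product. In the quotient the factorials
  cancel, and so do the powers of \<open>n\<close>, because
  \<open>1/6 + 5/6 = 1/3 + 2/3\<close>.\<close>

lemma pochhammer_quotient_tendsto_gamma_quotient:
  assumes "a + 1/3 \<notin> \<int>\<^sub>\<le>\<^sub>0" "a + 2/3 \<notin> \<int>\<^sub>\<le>\<^sub>0"
  shows "(\<lambda>n. pochhammer (a + 1/3) n * pochhammer (a + 2/3) n / (pochhammer (a + 1/6) n * pochhammer (a + 5/6) n))
    \<longlonglongrightarrow> gamma_quotient a"
proof -
  have "(\<lambda>n. (Gamma_series' (a + 1/6) n * Gamma_series' (a + 5/6) n) /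
      (Gamma_series' (a + 1/3) n * Gamma_series' (a + 2/3) n)) \<longlonglongrightarrow>
      (Gamma (a + 1/6) * Gamma (a + 5/6)) / (Gamma (a + 1/3) * Gamma (a + 2/3))"
    using assms by (intro tendsto_intros Gamma_series'_LIMSEQ) (auto simp: Gamma_eq_zero_iff)
  also have "(Gamma (a + 1/6) * Gamma (a + 5/6)) / (Gamma (a + 1/3) * Gamma (a + 2/3)) = gamma_quotient a"
    by (simp add: gamma_quotient_def rGamma_inverse_Gamma field_simps)
  also have "(\<lambda>n. (Gamma_series' (a + 1/6) n * Gamma_series' (a + 5/6) n) /
      (Gamma_series' (a + 1/3) n * Gamma_series' (a + 2/3) n)) =
      (\<lambda>n. pochhammer (a + 1/3) n * pochhammer (a + 2/3) n / (pochhammer (a + 1/6) n * pochhammer (a + 5/6) n))"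
  proof
    fix n :: nat
    define l where "l = complex_of_real (ln (real n))"
    have "exp ((a + 1/6) * l) * exp ((a + 5/6) * l) = exp ((a + 1/3) * l) * exp ((a + 2/3) * l)"
      by (simp add: algebra_simps flip: exp_add)
    then show "(Gamma_series' (a + 1/6) n * Gamma_series' (a + 5/6) n) /
        (Gamma_series' (a + 1/3) n * Gamma_series' (a + 2/3) n) =
        pochhammer (a + 1/3) n * pochhammer (a + 2/3) n / (pochhammer (a + 1/6) n * pochhammer (a + 5/6) n)"
      by (simp add: Gamma_series'_def l_def[symmetric] mult_ac)
  qed
  finally show ?thesis .
qed

section \<open>Comparison of the two sides\<close>

lemma nonpos_Ints_Re_le_0: "z \<in> \<int>\<^sub>\<le>\<^sub>0 \<Longrightarrow> Re z \<le> 0"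
  by (auto elim!: nonpos_Ints_cases)

text \<open>Iterating the recurrence \<open>n\<close> times never meets an excluded parameter or
  \<open>a = 0\<close> in this half-plane. The accumulated factor tends to the Gamma quotient and
  the remaining value to \<open>sqrt (3/5)\<close>.\<close>

lemma appell_special_Re_pos:
  assumes "Re a > 0"
  shows "appell_special a = complex_of_real (sqrt (3/5)) * gamma_quotient a"
proof -
  let ?P = "\<lambda>n. pochhammer (a + 1/3) n * pochhammer (a + 2/3) n / (pochhammer (a + 1/6) n * pochhammer (a + 5/6) n)"
  have iterate: "appell_special a = ?P n * appell_special (a + of_nat n)" for n
  proof (induction n)
    case (Suc n)
    have "3 * (a + of_nat n) + 1/2 \<notin> \<int>\<^sub>\<le>\<^sub>0"
      using nonpos_Ints_Re_le_0[of "3 * (a + of_nat n) + 1/2"] assms by auto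
    moreover have "a + of_nat n \<noteq> 0"
      using assms by (auto simp: complex_eq_iff)
    ultimately show ?case
      using Suc appell_special_rec[of "a + of_nat n"] by (simp add: pochhammer_Suc add_ac mult_ac)
  qed simp
  have "a + 1/3 \<notin> \<int>\<^sub>\<le>\<^sub>0" "a + 2/3 \<notin> \<int>\<^sub>\<le>\<^sub>0"
    using nonpos_Ints_Re_le_0[of "a + 1/3"] nonpos_Ints_Re_le_0[of "a + 2/3"] assms by auto
  from tendsto_mult[OF pochhammer_quotient_tendsto_gamma_quotient[OF this] appell_special_tendsto[of a]]
  have "(\<lambda>n. appell_special a) \<longlonglongrightarrow> gamma_quotient a * complex_of_real (sqrt (3/5))"
    unfolding iterate[symmetric] .
  then show ?thesis by (simp add: LIMSEQ_const_iff mult.commute)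
qed

text \<open>At \<open>a = 0\<close> the first binomial factor is 1 and \<gamma> equals \<alpha>, so
  all weights are 1 and the series sums to \<open>(1 + 4/5)^(1/2)\<close>.\<close>

lemma appell_special_0: "appell_special 0 = complex_of_real (sqrt (9/5))"
proof -
  have "(\<lambda>N. pochhammer (- 1/2) N / fact N * (- 4/5) ^ N) sums ((1 - (- 4/5)) powr - (- 1/2 :: complex))"
    by (rule binomial_series_neg) (simp add: norm_divide)
  also have "(1 - (- 4/5)) powr - (- 1/2 :: complex) = complex_of_real (sqrt (9/5))"
    using complex_powr_half[of "9/5"] by simp
  also have "(\<lambda>N. pochhammer (- 1/2) N / fact N * (- 4/5) ^ N) = appell_special_coeff 0"
  proof
    fix N
    have "binom_fps 0 (1/5) = 1"
      by (rule fps_ext) (simp add: fps_nth_binom_fps pochhammer_0_left)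
    moreover have "euler_weight (1/2) (1/2) N = 1"
    proof -
      have "pochhammer (1/2 :: complex) N \<noteq> 0"
        using half_not_nonpos_Int by (metis pochhammer_eq_0_iff minus_of_nat_in_nonpos_Ints)
      then show ?thesis by (simp add: euler_weight_def)
    qed
    ultimately show "pochhammer (- 1/2) N / fact N * (- 4/5) ^ N = appell_special_coeff 0 N"
      by (simp add: appell_special_coeff_def fps_nth_binom_fps)
  qed
  finally show ?thesis
    using half_not_nonpos_Int by (simp add: appell_special_eq_suminf sums_iff)
qed

text \<open>Both pairs of arguments sum to 1, so the reflection formula reduces the quotient to
  \<open>sin (pi/3) / sin (pi/6)\<close>.\<close>

lemma gamma_quotient_0: "gamma_quotient 0 = complex_of_real (sqrt 3)"
proof -
  have sin: "sin (complex_of_real pi / 6) = of_real (1/2)" "sin (complex_of_real pi / 3) = of_real (sqrt 3 / 2)"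
    using sin_of_real[of "pi/6", where 'a = complex] sin_of_real[of "pi/3", where 'a = complex]
    by (simp_all add: sin_30 sin_60)
  have "gamma_quotient 0 = of_real pi / sin (of_real pi / 6) * (sin (of_real pi / 3) / of_real pi)"
    using Gamma_reflection_complex[of "1/6"] rGamma_reflection_complex[of "1/3"]
    by (simp add: gamma_quotient_def)
  also have "\<dots> = complex_of_real (sqrt 3)"
    unfolding sin by simp
  finally show ?thesis .
qed

text \<open>Induction on the number of unit shifts that bring \<open>a\<close> into the right
  half-plane. Both sides obey the same recurrence except at \<open>a = 0\<close>, where the values
  are compared directly.\<close>

lemma appell_special_eq_gamma_quotient:
  assumes "3 * a + 1/2 \<notin> \<int>\<^sub>\<le>\<^sub>0"
  shows "appell_special a = complex_of_real (sqrt (3/5)) * gamma_quotient a"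
proof -
  obtain n :: nat where "Re a > - real n"
    using reals_Archimedean2[of "- Re a"] that by (metis minus_less_iff)
  then show ?thesis using assms
  proof (induction n arbitrary: a)
    case 0
    then show ?case by (intro appell_special_Re_pos) simp
  next
    case (Suc n)
    show ?case
    proof (cases "a = 0")
      case True
      \<comment> \<open>Here the identity is
        \<open>sqrt (9/5) = sqrt (3/5) * sqrt 3\<close>.\<close>
      then show ?thesis
        by (simp add: appell_special_0 gamma_quotient_0 flip: of_real_mult real_sqrt_mult)
    next
      case False
      have "3 * (a + 1) + 1/2 \<notin> \<int>\<^sub>\<le>\<^sub>0"
      proof
        assume "3 * (a + 1) + 1/2 \<in> \<int>\<^sub>\<le>\<^sub>0"
        then obtain k where "3 * (a + 1) + 1/2 = - of_nat k" by (elim nonpos_Ints_cases')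
        then have "3 * a + 1/2 = - of_nat (k + 3)" by (simp add: algebra_simps)
        then show False using Suc.prems(2) by (metis minus_of_nat_in_nonpos_Ints)
      qed
      moreover have "Re (a + 1) > - real n" using Suc.prems(1) by simp
      ultimately have "appell_special (a + 1) = complex_of_real (sqrt (3/5)) * gamma_quotient (a + 1)"
        by (intro Suc.IH)
      then show ?thesis
        by (simp only: appell_special_rec[OF Suc.prems(2) False] gamma_quotient_rec[OF Suc.prems(2)]
            mult.left_commute)
    qed
  qed
qed

theorem mainTheorem14:
  fixes a :: complex
  assumes "3 * a + 1/2 \<notin> \<int>\<^sub>\<le>\<^sub>0"
  shows "appell_F1 (1/2) (2 * a) (3 * a - 1/2) (3 * a + 1/2) (1/5) (- 4/5) =
    complex_of_real (sqrt (3/5)) * (Gamma (a + 1/6) * Gamma (a + 5/6)) *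
      (rGamma (a + 1/3) * rGamma (a + 2/3))"
  using appell_special_eq_gamma_quotient[OF assms]
  by (simp only: appell_special_def gamma_quotient_def mult.assoc)

end
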